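(* For all integers $n,m\ge1$, $$\mathrm{OPT}^{\mathrm{rand}}_n(m)=\mathrm{OPT}^{\mathrm{rand,full}}_n(m),$$ i.e. in the adversarial-order secretary problem, the optimal worst-case success probability of randomized policies with a single $\alpha$-power signal with $\alpha=m$ equals that of randomized policies that observe all $m$ independent uniform signals (both models are defined in the context).
   Context: Notation: $[n]=\{1,\dots,n\}$. Adversarial-order secretary problem: an adversary fixes an instance, i.e. a value vector $v\in\mathbb{N}_0^n$ with a unique maximum entry, located at a time $i^\star\in[n]$. Items arrive one by one at times $1,\dots,n$ in this order. At each time $t$ the policy observes $v_t$ together with the signal information described below, and then irrevocably decides whether to stop at time $t$. It knows $n$ and the signal parameter ($\alpha$ or $m$), but not the instance; it succeeds if it stops exactly at time $i^\star$. A randomized policy may use internal randomness independent of the signals. The worst-case success probability of a policy is the infimum over all instances of length $n$ of its success probability (over the signals and the internal randomness). Single $\alpha$-power signal model: one signal time $S\in[i^\star]$ is drawn with $\Pr[S=s]=\frac{s^\alpha-(s-1)^\alpha}{(i^\star)^\alpha}$ for $s\in[i^\star]$, and at time $t$ the policy observes whether $S=t$. $\mathrm{OPT}^{\mathrm{rand}}_n(\alpha)$ is the supremum of the worst-case success probability over all randomized policies in this model. (For $\alpha=m$ a positive integer, $S$ has the law of the maximum of $m$ independent uniform variables on $[i^\star]$.) Full-history model with $m$ signals: signal times $S_1,\dots,S_m$ are drawn independently and uniformly from $[i^\star]$, and at each time $t$ the policy observes the number of signals occurring at time $t$. $\mathrm{OPT}^{\mathrm{rand,full}}_n(m)$ is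 the supremum of the worst-case success probability over all randomized policies in this model. *)

theory Defs
  imports "HOL-Probability.Probability"
begin

definition is_max :: "nat \<Rightarrow> (nat \<Rightarrow> nat) \<Rightarrow> nat \<Rightarrow> bool" where
  "is_max n v i \<longleftrightarrow> i \<in> {1..n} \<and> (\<forall>j\<in>{1..n}. v j \<le> v i)"

definition instances :: "nat \<Rightarrow> (nat \<Rightarrow> nat) set" where
  "instances n = {v \<in> {1..n} \<rightarrow>\<^sub>E UNIV. \<exists>!i. is_max n v i}"

definition best_time :: "nat \<Rightarrow> (nat \<Rightarrow> nat) \<Rightarrow> nat" where
  "best_time n v = (THE i. is_max n v i)"

text \<open>
  At time \<open>t\<close> a policy has seen the pairs (value, signal observation) of times \<open>1, \<dots>, t\<close>;
  \<open>'o\<close> is the type of the signal observation made at a single time. A deterministic policy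
  tells for every history whether to stop; the decision only matters as long as the policy
  has not stopped before.
\<close>

type_synonym 'o policy = "(nat \<times> 'o) list \<Rightarrow> bool"

definition history :: "(nat \<Rightarrow> nat) \<Rightarrow> (nat \<Rightarrow> 'o) \<Rightarrow> nat \<Rightarrow> (nat \<times> 'o) list" where
  "history v x t = map (\<lambda>k. (v k, x k)) [1..<t + 1]"

definition stops_at :: "'o policy \<Rightarrow> (nat \<Rightarrow> nat) \<Rightarrow> (nat \<Rightarrow> 'o) \<Rightarrow> nat \<Rightarrow> bool" where
  "stops_at d v x t \<longleftrightarrow> d (history v x t) \<and> (\<forall>s\<in>{1..<t}. \<not> d (history v x s))"

text \<open>
  A randomized policy is given by the law of the deterministic policy that results once the
  internal randomness has been drawn. The \<open>\<sigma>\<close>-algebra is the one generated by the individual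
  decisions, so every source of internal randomness for which each decision is an event
  induces such a law.
\<close>

definition randomized_policies :: "'o policy measure set" where
  "randomized_policies = {P. prob_space P \<and> sets P = sets (\<Pi>\<^sub>M h\<in>UNIV. count_space UNIV)}"

text \<open>
  A signal model assigns to every possible time \<open>i\<close> of the maximum the law of the sequence
  of signal observations. The product measure expresses that the internal randomness is
  independent of the signals.
\<close>

type_synonym 'o signal_model = "nat \<Rightarrow> (nat \<Rightarrow> 'o) pmf"

definition success_prob :: "'o signal_model \<Rightarrow> nat \<Rightarrow> 'o policy measure \<Rightarrow> (nat \<Rightarrow> nat) \<Rightarrow> real" where
  "success_prob Q n P v =
     measure (P \<Otimes>\<^sub>M measure_pmf (Q (best_time n v))) {(d, x). stops_at d v x (best_time n v)}"

definition worst_case_success :: "'o signal_model \<Rightarrow> nat \<Rightarrow> 'o policy measure \<Rightarrow> real" where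
  "worst_case_success Q n P = (INF v\<in>instances n. success_prob Q n P v)"

definition opt_value :: "'o signal_model \<Rightarrow> nat \<Rightarrow> real" where
  "opt_value Q n = (SUP P\<in>randomized_policies. worst_case_success Q n P)"

definition power_signal :: "real \<Rightarrow> nat \<Rightarrow> nat pmf" where
  "power_signal \<alpha> i =
     embed_pmf (\<lambda>s. if s \<in> {1..i} then (real s powr \<alpha> - (real s - 1) powr \<alpha>) / real i powr \<alpha> else 0)"

lemma pmf_power_signal:
  assumes "\<alpha> > 0" "i \<ge> 1"
  shows "pmf (power_signal \<alpha> i) s =
    (if s \<in> {1..i} then (real s powr \<alpha> - (real s - 1) powr \<alpha>) / real i powr \<alpha> else 0)"
  unfolding power_signal_def
proof (rule pmf_embed_pmf)
  let ?f = "\<lambda>s. if s \<in> {1..i} then (real s powr \<alpha> - (real s - 1) powr \<alpha>) / real i powr \<alpha> else 0"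
  show nn: "0 \<le> ?f s" for s
    using assms by (auto intro!: divide_nonneg_nonneg powr_mono2)
  have tel: "(\<Sum>s\<in>{1..k}. real s powr \<alpha> - (real s - 1) powr \<alpha>) = real k powr \<alpha>" for k :: nat
    by (induction k) auto
  have "(\<integral>\<^sup>+ s. ennreal (?f s) \<partial>count_space UNIV) = (\<Sum>s\<in>{1..i}. ennreal (?f s))"
    by (rule nn_integral_count_space') auto
  also have "\<dots> = ennreal (\<Sum>s\<in>{1..i}. ?f s)"
    by (rule sum_ennreal) (rule nn)
  also have "(\<Sum>s\<in>{1..i}. ?f s) = (\<Sum>s\<in>{1..i}. real s powr \<alpha> - (real s - 1) powr \<alpha>) / real i powr \<alpha>"
    unfolding sum_divide_distrib by (rule sum.cong) auto
  also have "\<dots> = 1"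
    unfolding tel using assms by simp
  finally show "(\<integral>\<^sup>+ s. ennreal (?f s) \<partial>count_space UNIV) = 1"
    by simp
qed

definition single_signal_model :: "real \<Rightarrow> bool signal_model" where
  "single_signal_model \<alpha> i = map_pmf (\<lambda>S t. S = t) (power_signal \<alpha> i)"

definition full_history_model :: "nat \<Rightarrow> nat signal_model" where
  "full_history_model m i =
     map_pmf (\<lambda>S t. card {k \<in> {1..m}. S k = t}) (Pi_pmf {1..m} 0 (\<lambda>_. pmf_of_set {1..i}))"

definition OPT_rand :: "nat \<Rightarrow> real \<Rightarrow> real" where
  "OPT_rand n \<alpha> = opt_value (single_signal_model \<alpha>) n"

definition OPT_rand_full :: "nat \<Rightarrow> nat \<Rightarrow> real" where
  "OPT_rand_full n m = opt_value (full_history_model m) n"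

end

theory Submission
  imports Defs
begin

text \<open>
  The last of the \<open>m\<close> uniform signals has the \<open>m\<close>-power law, and a policy that sees the counts
  recognizes it as the signal at which the total reaches \<open>m\<close>; so full history is at least as good.
  Conversely, no signal comes after the maximum, so a policy loses nothing by waiting
  for the last signal. Given that the last signal is at time \<open>s\<close>, the law of the counts does not
  depend on the position of the maximum. Hence a policy that sees only the last signal can draw
  the counts from this law at time \<open>s\<close> and from then on imitate a full-history policy.
\<close>

section \<open>Measurability and the success probability as an integral over the signals\<close>

abbreviation policy_space :: "'o policy measure" where
  "policy_space \<equiv> \<Pi>\<^sub>M h\<in>UNIV. count_space UNIV"

lemma randomized_policiesD:
  assumes "P \<in> randomized_policies"
  shows "prob_space P" "sets P = sets policy_space" "space P = UNIV"
  using assms sets_eq_imp_space_eq[of P policy_space]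
  by (auto simp: randomized_policies_def space_PiM)

text \<open>The product \<sigma>-algebra only makes the decision at a fixed history measurable.
  There are countably many histories, so the argument may be random too.\<close>

lemma decision_measurable:
  fixes F :: "'a \<Rightarrow> 'o::countable policy"
  assumes F: "F \<in> N \<rightarrow>\<^sub>M policy_space" and G: "G \<in> N \<rightarrow>\<^sub>M count_space UNIV"
  shows "Measurable.pred N (\<lambda>\<omega>. F \<omega> (G \<omega>))"
proof (rule measurable_compose_countable[OF _ G])
  fix h :: "(nat \<times> 'o) list"
  show "Measurable.pred N (\<lambda>\<omega>. F \<omega> h)"
    using measurable_compose[OF F measurable_component_singleton[of h]] by simp
qed

lemma stops_at_measurable:
  fixes F :: "'a \<Rightarrow> 'o::countable policy"
  assumes F: "F \<in> N \<rightarrow>\<^sub>M policy_space" and G: "G \<in> N \<rightarrow>\<^sub>M count_space UNIV"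
  shows "Measurable.pred N (\<lambda>\<omega>. stops_at (F \<omega>) v (G \<omega>) i)"
proof -
  have [measurable]: "Measurable.pred N (\<lambda>\<omega>. F \<omega> (history v (G \<omega>) t))" for t
    by (rule decision_measurable[OF F]) (rule measurable_compose[OF G], simp)
  show ?thesis
    unfolding stops_at_def by measurable
qed

text \<open>Tonelli, with the policy integrated first. The map \<open>g\<close> lets the
  observations be a function of a larger random object, such as one coordinate of a family of count
  sequences.\<close>

lemma emeasure_pair_stops_at:
  fixes P :: "'o::countable policy measure" and Q :: "'a pmf"
  assumes P: "P \<in> randomized_policies"
  shows "emeasure (P \<Otimes>\<^sub>M measure_pmf Q) {(d, y). stops_at d v (g y) i} =
    (\<integral>\<^sup>+ y. emeasure P {d. stops_at d v (g y) i} \<partial>measure_pmf Q)"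
proof -
  note PD = randomized_policiesD[OF P]
  interpret prob_space P by (rule PD)
  interpret pair_sigma_finite P "measure_pmf Q" ..
  have [measurable_cong]: "sets P = sets policy_space" by (rule PD)
  have "Measurable.pred (P \<Otimes>\<^sub>M measure_pmf Q) (\<lambda>\<omega>. stops_at (fst \<omega>) v (g (snd \<omega>)) i)"
    by (rule stops_at_measurable) (measurable, rule measurable_compose[OF measurable_snd], simp)
  then have "{(d, y). stops_at d v (g y) i} \<in> sets (P \<Otimes>\<^sub>M measure_pmf Q)"
    by (simp add: pred_def space_pair_measure PD case_prod_unfold)
  from emeasure_pair_measure_alt2[OF this] show ?thesis
    by (simp add: vimage_def)
qed

lemma success_prob_eq_nn_integral:
  fixes P :: "'o::countable policy measure"
  assumes P: "P \<in> randomized_policies"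
  shows "ennreal (success_prob Q n P v) =
    (\<integral>\<^sup>+ x. emeasure P {d. stops_at d v x (best_time n v)} \<partial>measure_pmf (Q (best_time n v)))"
proof -
  interpret policy: prob_space P by (rule randomized_policiesD[OF P])
  interpret joint: pair_prob_space P "measure_pmf (Q (best_time n v))" ..
  show ?thesis
    unfolding success_prob_def joint.emeasure_eq_measure[symmetric]
    by (rule emeasure_pair_stops_at[OF P, where g = "\<lambda>x. x"])
qed

text \<open>Both reductions build the new policy as a measurable transform of the old one, possibly
  with extra randomness; this transfers success events back to the source space.\<close>

lemma distr_randomized_policy:
  fixes T :: "'a \<Rightarrow> 'o::countable policy"
  assumes "prob_space N" and T: "T \<in> N \<rightarrow>\<^sub>M policy_space"
  shows "distr N policy_space T \<in> randomized_policies"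
    and "emeasure (distr N policy_space T) {d. stops_at d v x i} =
      emeasure N {\<omega> \<in> space N. stops_at (T \<omega>) v x i}"
proof -
  show "distr N policy_space T \<in> randomized_policies"
    using prob_space.prob_space_distr[OF assms] by (simp add: randomized_policies_def)
  have "Measurable.pred policy_space (\<lambda>d :: 'o policy. stops_at d v x i)"
    by (rule stops_at_measurable[where G = "\<lambda>_. x"]) auto
  then have "{d :: 'o policy. stops_at d v x i} \<in> sets policy_space"
    by (simp add: pred_def space_PiM)
  then show "emeasure (distr N policy_space T) {d. stops_at d v x i} =
      emeasure N {\<omega> \<in> space N. stops_at (T \<omega>) v x i}"
    by (subst emeasure_distr[OF T]) (auto intro!: arg_cong[where f = "emeasure N"])
qed

section \<open>Comparing optimal values instance by instance\<close>

lemma instances_nonempty: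
  assumes "n \<ge> 1"
  shows "instances n \<noteq> {}"
proof -
  let ?v = "\<lambda>i\<in>{1..n}. if i = 1 then 1 else 0 :: nat"
  have "\<exists>!i. is_max n ?v i"
  proof (rule ex1I)
    show "is_max n ?v 1"
      using assms by (auto simp: is_max_def)
  next
    fix i assume "is_max n ?v i"
    then have "i \<in> {1..n}" "\<forall>j\<in>{1..n}. ?v j \<le> ?v i"
      unfolding is_max_def by blast+
    moreover from this(2) have "?v 1 \<le> ?v i"
      by (rule bspec) (use assms in simp)
    ultimately show "i = 1"
      using assms by (simp split: if_splits)
  qed
  moreover have "?v \<in> {1..n} \<rightarrow>\<^sub>E UNIV"
    by simp
  ultimately have "?v \<in> instances n"
    unfolding instances_def mem_Collect_eq by (rule conjI[rotated])
  then show ?thesis by blast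
qed

lemma best_time_in:
  assumes "v \<in> instances n"
  shows "best_time n v \<in> {1..n}"
proof -
  have "\<exists>!i. is_max n v i"
    using assms unfolding instances_def mem_Collect_eq by (rule conjunct2)
  then have "is_max n v (best_time n v)"
    unfolding best_time_def by (rule theI')
  then show ?thesis by (simp add: is_max_def)
qed

text \<open>Domination on every instance passes to the infimum and then to the supremum. Over the
  reals this takes nonempty and bounded index families, which the proof supplies: the policy that
  always stops, some instance \<open>v0\<close>, and the bounds 0 and 1.\<close>

lemma opt_value_mono:
  fixes Q :: "'o::countable signal_model" and Q' :: "'p::countable signal_model"
  assumes n: "n \<ge> 1"
    and dom: "\<And>P. P \<in> randomized_policies \<Longrightarrow>
      \<exists>P'\<in>randomized_policies. \<forall>v\<in>instances n. success_prob Q n P v \<le> success_prob Q' n P' v"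
  shows "opt_value Q n \<le> opt_value Q' n"
  unfolding opt_value_def
proof (rule cSUP_least)
  have "return policy_space (\<lambda>_. True) \<in> (randomized_policies :: 'o policy measure set)"
    by (auto simp: randomized_policies_def space_PiM intro!: prob_space_return)
  then show "(randomized_policies :: 'o policy measure set) \<noteq> {}" by blast
next
  fix P :: "'o policy measure" assume "P \<in> randomized_policies"
  from dom[OF this] obtain P' where P': "P' \<in> randomized_policies"
    and le: "\<And>v. v \<in> instances n \<Longrightarrow> success_prob Q n P v \<le> success_prob Q' n P' v"
    by blast
  obtain v0 where v0: "v0 \<in> instances n"
    using instances_nonempty[OF n] by blast
  have bdd: "bdd_below (success_prob R n P'' ` instances n)"
    for R :: "'q signal_model" and P''
    by (rule bdd_belowI2[of _ 0]) (simp add: success_prob_def)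
  have "worst_case_success Q' n R \<le> 1" if R: "R \<in> randomized_policies" for R
  proof -
    interpret policy: prob_space R by (rule randomized_policiesD[OF R])
    interpret joint: pair_prob_space R "measure_pmf (Q' (best_time n v0))" ..
    have "worst_case_success Q' n R \<le> success_prob Q' n R v0"
      unfolding worst_case_success_def by (rule cINF_lower[OF bdd v0])
    also have "\<dots> \<le> 1" unfolding success_prob_def by (rule joint.prob_le_1)
    finally show ?thesis .
  qed
  then have "bdd_above (worst_case_success Q' n ` randomized_policies)"
    by (rule bdd_aboveI2)
  moreover have "worst_case_success Q n P \<le> worst_case_success Q' n P'"
    unfolding worst_case_success_def
    by (rule cINF_mono[OF instances_nonempty[OF n] bdd]) (use le in blast)
  ultimately show "worst_case_success Q n P \<le> (SUP P\<in>randomized_policies. worst_case_success Q' n P)"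
    by (intro cSUP_upper2[OF _ P'])
qed

section \<open>Uniform signal tuples and the law of the last signal\<close>

text \<open>The default 0 outside \<open>{1..m}\<close> matches \<open>Pi_pmf\<close> in the
  full-history model, whose joint law is thereby uniform on this finite set.\<close>

definition signal_tuples :: "nat \<Rightarrow> nat \<Rightarrow> (nat \<Rightarrow> nat) set" where
  "signal_tuples m i = PiE_dflt {1..m} 0 (\<lambda>_. {1..i})"

definition last_signal :: "nat \<Rightarrow> (nat \<Rightarrow> nat) \<Rightarrow> nat" where
  "last_signal m S = Max (S ` {1..m})"

definition signal_counts :: "nat \<Rightarrow> (nat \<Rightarrow> nat) \<Rightarrow> nat \<Rightarrow> nat" where
  "signal_counts m S t = card {k \<in> {1..m}. S k = t}"

lemma finite_signal_tuples [simp]: "finite (signal_tuples m i)"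
  unfolding signal_tuples_def by (rule finite_PiE_dflt) auto

lemma card_signal_tuples: "card (signal_tuples m i) = i ^ m"
  unfolding signal_tuples_def by (subst card_PiE_dflt) auto

lemma signal_tuples_nonempty: "i \<ge> 1 \<Longrightarrow> signal_tuples m i \<noteq> {}"
  using card_signal_tuples[of m i] by auto

lemma signal_tuplesD: "S \<in> signal_tuples m i \<Longrightarrow> k \<in> {1..m} \<Longrightarrow> S k \<in> {1..i}"
  unfolding signal_tuples_def PiE_dflt_def by blast

lemma signal_tuples_change_bound:
  assumes "S \<in> signal_tuples m i"
  shows "S \<in> signal_tuples m j \<longleftrightarrow> (\<forall>k\<in>{1..m}. S k \<le> j)"
proof -
  have "S k \<in> {1..j} \<longleftrightarrow> S k \<le> j" if "k \<in> {1..m}" for k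
    using signal_tuplesD[OF assms that] by simp
  then show ?thesis
    using assms unfolding signal_tuples_def PiE_dflt_def mem_Collect_eq by blast
qed

lemma signal_tuples_mono: "i \<le> j \<Longrightarrow> signal_tuples m i \<subseteq> signal_tuples m j"
  using signal_tuples_change_bound signal_tuplesD by fastforce

lemma last_signal_in:
  assumes "m \<ge> 1" "S \<in> signal_tuples m i"
  shows "last_signal m S \<in> {1..i}"
proof -
  have "last_signal m S \<in> S ` {1..m}"
    unfolding last_signal_def by (rule Max_in) (use assms(1) in simp_all)
  then obtain k where k: "k \<in> {1..m}" and eq: "last_signal m S = S k" ..
  show ?thesis
    unfolding eq using signal_tuplesD[OF assms(2) k] .
qed

text \<open>The maximum is \<open>s\<close> iff all entries are at most \<open>s\<close> but not all
  are at most \<open>s - 1\<close>. The right-hand side is free of \<open>i\<close>: this is why the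
  last signal screens off the position of the maximum.\<close>

lemma last_signal_level_set:
  assumes "m \<ge> 1" "s \<in> {1..i}"
  shows "signal_tuples m i \<inter> {S. last_signal m S = s} = signal_tuples m s - signal_tuples m (s - 1)"
proof -
  have le: "last_signal m S \<le> j \<longleftrightarrow> (\<forall>k\<in>{1..m}. S k \<le> j)" for S j
    unfolding last_signal_def using assms by (subst Max_le_iff) auto
  have level: "last_signal m S = s \<longleftrightarrow> last_signal m S \<le> s \<and> \<not> last_signal m S \<le> s - 1" for S
    using assms(2) by auto
  have "S \<in> signal_tuples m i \<and> last_signal m S = s \<longleftrightarrow>
      S \<in> signal_tuples m s \<and> S \<notin> signal_tuples m (s - 1)" for S
  proof (cases "S \<in> signal_tuples m i")
    case True
    then show ?thesis unfolding level le signal_tuples_change_bound[OF True] by simp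
  next
    case False
    then show ?thesis using signal_tuples_mono[of s i m] assms(2) by auto
  qed
  then show ?thesis by blast
qed

lemma full_history_model_eq:
  assumes "i \<ge> 1"
  shows "full_history_model m i = map_pmf (signal_counts m) (pmf_of_set (signal_tuples m i))"
  unfolding full_history_model_def signal_tuples_def using assms
  by (subst Pi_pmf_of_set) (auto simp: signal_counts_def[abs_def])

text \<open>Counting: \<open>s ^ m - (s - 1) ^ m\<close> of the \<open>i ^ m\<close> equally likely
  tuples have their maximum at \<open>s\<close>.\<close>

lemma power_signal_eq:
  assumes "m \<ge> 1" "i \<ge> 1"
  shows "power_signal (real m) i = map_pmf (last_signal m) (pmf_of_set (signal_tuples m i))"
proof (rule pmf_eqI)
  fix s
  have *: "pmf (map_pmf (last_signal m) (pmf_of_set (signal_tuples m i))) s =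
      card (signal_tuples m i \<inter> {S. last_signal m S = s}) / i ^ m"
    using assms by (simp add: pmf_map measure_pmf_of_set signal_tuples_nonempty
        card_signal_tuples vimage_def)
  show "pmf (power_signal (real m) i) s =
      pmf (map_pmf (last_signal m) (pmf_of_set (signal_tuples m i))) s"
  proof (cases "s \<in> {1..i}")
    case True
    have "card (signal_tuples m i \<inter> {S. last_signal m S = s}) = s ^ m - (s - 1) ^ m"
      unfolding last_signal_level_set[OF assms(1) True]
      by (subst card_Diff_subset) (auto simp: card_signal_tuples intro: signal_tuples_mono[THEN subsetD, rotated])
    moreover have "(s - 1) ^ m \<le> s ^ m"
      by (rule power_mono) auto
    \<comment> \<open>For \<open>s = 1\<close> the base \<open>real s - 1\<close> is 0, where
      \<open>powr\<close> and the natural power agree because the exponent is positive.\<close>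
    ultimately show ?thesis
      unfolding * using True assms
      by (subst pmf_power_signal) (auto simp: of_nat_diff powr_realpow')
  next
    case False
    then have "signal_tuples m i \<inter> {S. last_signal m S = s} = {}"
      using last_signal_in[OF assms(1)] by blast
    with False show ?thesis
      unfolding * using assms by (subst pmf_power_signal) auto
  qed
qed

section \<open>Conditional law of the counts given the last signal\<close>

lemma cond_pmf_of_set:
  assumes "finite A" "A \<inter> B \<noteq> {}"
  shows "cond_pmf (pmf_of_set A) B = pmf_of_set (A \<inter> B)"
proof -
  have "A \<noteq> {}" using assms by auto
  show ?thesis
  proof (rule pmf_eqI)
    fix x
    have "card (A \<inter> B) > 0" "card A > 0"
      using assms by (auto simp: card_gt_0_iff)
    then show "pmf (cond_pmf (pmf_of_set A) B) x = pmf (pmf_of_set (A \<inter> B)) x"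
      using assms \<open>A \<noteq> {}\<close>
      by (subst pmf_cond) (auto simp: measure_pmf_of_set indicator_def Int_commute)
  qed
qed

text \<open>A kernel without reference to the position of the maximum, so a policy can sample from
  it. Only \<open>s \<ge> 1\<close> matters; at 0 the set of tuples is empty.\<close>

definition counts_given_last :: "nat \<Rightarrow> nat \<Rightarrow> (nat \<Rightarrow> nat) pmf" where
  "counts_given_last m s =
     map_pmf (signal_counts m) (pmf_of_set (signal_tuples m s - signal_tuples m (s - 1)))"

text \<open>Conditioning the uniform law on the value of the last signal gives the uniform law on a
  level set, which is the same for all \<open>i \<ge> s\<close>.\<close>

lemma full_history_model_disintegration:
  assumes "m \<ge> 1" "i \<ge> 1"
  shows "full_history_model m i = bind_pmf (power_signal (real m) i) (counts_given_last m)"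
proof -
  let ?T = "pmf_of_set (signal_tuples m i)" and ?M = "power_signal (real m) i"
  have set_T: "set_pmf ?T = signal_tuples m i"
    using assms by (simp add: signal_tuples_nonempty)
  have set_M: "set_pmf ?M = last_signal m ` signal_tuples m i"
    unfolding power_signal_eq[OF assms] by (simp add: set_T)
  have "?T = bind_pmf ?M (\<lambda>s. cond_pmf ?T {S. last_signal m S = s})"
  \<comment> \<open>The relation is the graph of \<open>last_signal\<close>; what has to be checked
    is that the fibre over \<open>s\<close> has the mass that the law of the last signal gives to
    \<open>s\<close>.\<close>
  proof (rule bind_cond_pmf_cancel[symmetric])
    fix s S assume "last_signal m S = s"
    then show "measure ?T {S. last_signal m S = s} = measure ?M {s. last_signal m S = s}"
      unfolding power_signal_eq[OF assms] by (simp add: vimage_def eq_commute)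
  qed (auto simp: set_T set_M)
  also have "\<dots> = bind_pmf ?M (\<lambda>s. pmf_of_set (signal_tuples m s - signal_tuples m (s - 1)))"
  proof (rule bind_pmf_cong[OF refl])
    fix s assume s: "s \<in> set_pmf ?M"
    then have "signal_tuples m i \<inter> {S. last_signal m S = s} \<noteq> {}"
      by (auto simp: set_M)
    moreover have "s \<in> {1..i}"
      using s last_signal_in[OF assms(1)] by (auto simp: set_M)
    ultimately show "cond_pmf ?T {S. last_signal m S = s} =
        pmf_of_set (signal_tuples m s - signal_tuples m (s - 1))"
      by (metis cond_pmf_of_set finite_signal_tuples last_signal_level_set[OF assms(1)])
  qed
  finally show ?thesis
    by (simp add: full_history_model_eq[OF assms(2)] map_bind_pmf counts_given_last_def[abs_def])
qed

section \<open>Full history is at least as good as the last signal\<close>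

text \<open>The total stays at \<open>m\<close> after the last signal, so a positive count at
  \<open>t\<close> is demanded as well. Only counts up to \<open>t\<close> enter, so a policy can
  evaluate this online.\<close>

definition detect_last :: "nat \<Rightarrow> (nat \<Rightarrow> nat) \<Rightarrow> nat \<Rightarrow> bool" where
  "detect_last m c t \<longleftrightarrow> 0 < c t \<and> (\<Sum>j\<in>{1..t}. c j) = m"

text \<open>The shift by 1 reconciles times, which start at 1, with list positions, which start at
  0.\<close>

definition detect_last_history :: "nat \<Rightarrow> (nat \<times> nat) list \<Rightarrow> (nat \<times> bool) list" where
  "detect_last_history m h =
     map (\<lambda>k. (fst (h ! (k - 1)), detect_last m (\<lambda>j. snd (h ! (j - 1))) k)) [1..<length h + 1]"

lemma length_history [simp]: "length (history v x t) = t"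
  by (simp add: history_def)

lemma nth_history: "Suc 0 \<le> k \<Longrightarrow> k \<le> t \<Longrightarrow> history v x t ! (k - Suc 0) = (v k, x k)"
  by (auto simp: history_def nth_map simp del: upt_Suc)

lemma detect_last_history_history:
  "detect_last_history m (history v c t) = history v (detect_last m c) t"
  unfolding detect_last_history_def length_history
  unfolding history_def[of v "detect_last m c"]
proof (rule map_cong[OF refl])
  fix k assume "k \<in> set [1..<t + 1]"
  then have k: "k \<in> {1..t}" by auto
  then have "(\<Sum>j\<in>{1..k}. snd (history v c t ! (j - 1))) = (\<Sum>j\<in>{1..k}. c j)"
    by (intro sum.cong) (auto simp: nth_history)
  with k show "(fst (history v c t ! (k - 1)), detect_last m (\<lambda>j. snd (history v c t ! (j - 1))) k) =
      (v k, detect_last m c k)"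
    by (simp add: detect_last_def nth_history)
qed

lemma detect_last_signal_counts:
  assumes "m \<ge> 1" "S \<in> signal_tuples m i"
  shows "detect_last m (signal_counts m S) = (\<lambda>t. last_signal m S = t)"
proof
  fix t
  have pos: "S k \<ge> 1" if "k \<in> {1..m}" for k
    using signal_tuplesD[OF assms(2) that] by simp
  have "(\<Sum>j\<in>{1..t}. signal_counts m S j) = card (\<Union>j\<in>{1..t}. {k \<in> {1..m}. S k = j})"
    unfolding signal_counts_def by (rule card_UN_disjoint[symmetric]) auto
  \<comment> \<open>No signal time is 0, so summing the counts from time 1 misses no signal.\<close>
  also have "(\<Union>j\<in>{1..t}. {k \<in> {1..m}. S k = j}) = {k \<in> {1..m}. S k \<le> t}"
    using pos by fastforce
  finally have "(\<Sum>j\<in>{1..t}. signal_counts m S j) = card {k \<in> {1..m}. S k \<le> t}" .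
  moreover have "card {k \<in> {1..m}. S k \<le> t} = m \<longleftrightarrow> {k \<in> {1..m}. S k \<le> t} = {1..m}"
  proof
    assume "card {k \<in> {1..m}. S k \<le> t} = m"
    then show "{k \<in> {1..m}. S k \<le> t} = {1..m}"
      by (intro card_subset_eq) auto
  qed simp
  moreover have "0 < signal_counts m S t \<longleftrightarrow> t \<in> S ` {1..m}"
    by (auto simp: signal_counts_def card_gt_0_iff)
  moreover have "last_signal m S = t \<longleftrightarrow> t \<in> S ` {1..m} \<and> (\<forall>k\<in>{1..m}. S k \<le> t)"
    unfolding last_signal_def using assms by (subst Max_eq_iff) auto
  ultimately show "detect_last m (signal_counts m S) t = (last_signal m S = t)"
    by (auto simp: detect_last_def)
qed

text \<open>\<open>detect_last\<close> pushes the law of the counts to the law of the single-signal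
  observations, so the composed policy has exactly the same success probability on every
  instance.\<close>

lemma single_signal_le_full_history:
  assumes n: "n \<ge> 1" and m: "m \<ge> 1"
  shows "opt_value (single_signal_model (real m)) n \<le> opt_value (full_history_model m) n"
proof (rule opt_value_mono[OF n], intro bexI ballI)
  fix P :: "bool policy measure" assume P: "P \<in> randomized_policies"
  note PD = randomized_policiesD[OF P]
  let ?T = "\<lambda>d h. d (detect_last_history m h)"
  let ?P' = "distr P policy_space ?T"
  have [measurable_cong]: "sets P = sets policy_space" by (rule PD)
  have T: "?T \<in> P \<rightarrow>\<^sub>M policy_space"
    by (rule measurable_PiM_single') (auto simp: measurable_component_singleton space_PiM)
  show P': "?P' \<in> randomized_policies"
    by (rule distr_randomized_policy[OF PD(1) T])
  fix v assume "v \<in> instances n"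
  then have i: "best_time n v \<ge> 1" using best_time_in by fastforce
  let ?i = "best_time n v"
  have "stops_at (?T d) v x ?i = stops_at d v (detect_last m x) ?i" for d x
    by (simp add: stops_at_def detect_last_history_history)
  then have E: "emeasure ?P' {d. stops_at d v x ?i} =
      emeasure P {d. stops_at d v (detect_last m x) ?i}" for x
    by (subst distr_randomized_policy(2)[OF PD(1) T]) (simp add: PD)
  have "single_signal_model (real m) ?i = map_pmf (detect_last m) (full_history_model m ?i)"
    unfolding single_signal_model_def power_signal_eq[OF m i] full_history_model_eq[OF i]
      map_pmf_comp
    by (rule map_pmf_cong) (use i in \<open>simp_all add: detect_last_signal_counts[OF m] signal_tuples_nonempty\<close>)
  then have "ennreal (success_prob (single_signal_model (real m)) n P v) =
      ennreal (success_prob (full_history_model m) n ?P' v)"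
    unfolding success_prob_eq_nn_integral[OF P] success_prob_eq_nn_integral[OF P'] E by simp
  then show "success_prob (single_signal_model (real m)) n P v \<le>
      success_prob (full_history_model m) n ?P' v"
    by (simp add: success_prob_def)
qed

section \<open>Simulating the full history from the last signal\<close>

text \<open>
  A history of the single-signal model contains at most one positive observation, so the
  quantifier below just reads off its time \<open>s\<close>. The counts \<open>C s\<close> are drawn in advance for every
  possible \<open>s\<close> as internal randomness.
\<close>

definition simulate :: "nat policy \<Rightarrow> (nat \<Rightarrow> nat \<Rightarrow> nat) \<Rightarrow> bool policy" where
  "simulate d C h \<longleftrightarrow> (\<exists>s\<in>{1..length h}. snd (h ! (s - 1)) \<and>
     d (map (\<lambda>k. (fst (h ! (k - 1)), C s k)) [1..<length h + 1]))"

lemma simulate_history: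
  assumes "s \<ge> 1"
  shows "simulate d C (history v (\<lambda>t. s = t) t) \<longleftrightarrow> s \<le> t \<and> d (history v (C s) t)"
proof -
  have H: "map (\<lambda>k. (fst (history v (\<lambda>t. s = t) t ! (k - 1)), C s' k)) [1..<t + 1] = history v (C s') t" for s'
    unfolding history_def[of v "C s'"] by (rule map_cong) (auto simp: nth_history simp del: upt_Suc)
  have "snd (history v (\<lambda>t. s = t) t ! (s' - 1)) \<longleftrightarrow> s' = s" if "s' \<in> {1..t}" for s'
    using that by (auto simp: nth_history)
  then have "simulate d C (history v (\<lambda>t. s = t) t) \<longleftrightarrow> (\<exists>s'\<in>{1..t}. s' = s \<and> d (history v (C s') t))"
    unfolding simulate_def length_history H by (intro bex_cong) (simp_all only:)
  also have "\<dots> \<longleftrightarrow> s \<le> t \<and> d (history v (C s) t)"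
    using assms by auto
  finally show ?thesis .
qed

text \<open>Before \<open>s\<close> the simulation never stops, and from \<open>s\<close> on it
  decides as \<open>d\<close> does on the counts \<open>C s\<close>. It is only an implication:
  where \<open>d\<close> stops before \<open>s\<close>, the simulation may still succeed.\<close>

lemma stops_at_simulate:
  assumes "s \<in> {1..i}" "stops_at d v (C s) i"
  shows "stops_at (simulate d C) v (\<lambda>t. s = t) i"
  using assms by (auto simp: stops_at_def simulate_history)

text \<open>The comparison is made for each fixed value \<open>s\<close> of the last signal and then
  averaged over its law, which is that of the single signal.\<close>

lemma full_history_le_single_signal:
  assumes n: "n \<ge> 1" and m: "m \<ge> 1"
  shows "opt_value (full_history_model m) n \<le> opt_value (single_signal_model (real m)) n"
proof (rule opt_value_mono[OF n], intro bexI ballI)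
  fix P :: "nat policy measure" assume P: "P \<in> randomized_policies"
  note PD = randomized_policiesD[OF P]
  interpret policy: prob_space P by (rule PD)
  \<comment> \<open>One count sequence for every possible last signal; the range up to
    \<open>n\<close> is known to the policy, while the position of the maximum is not.\<close>
  let ?K = "Pi_pmf {1..n} (\<lambda>_. 0) (counts_given_last m)"
  let ?N = "P \<Otimes>\<^sub>M measure_pmf ?K"
  let ?T = "\<lambda>(d, C). simulate d C"
  let ?P' = "distr ?N policy_space ?T"
  interpret joint: pair_prob_space P "measure_pmf ?K" ..
  have [measurable_cong]: "sets P = sets policy_space" by (rule PD)
  have space_N: "space ?N = UNIV" by (simp add: space_pair_measure PD)
  have T: "?T \<in> ?N \<rightarrow>\<^sub>M policy_space"
  proof (rule measurable_PiM_single')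
    fix h :: "(nat \<times> bool) list"
    have [measurable]: "Measurable.pred ?N (\<lambda>\<omega>. fst \<omega> (map (\<lambda>k. (fst (h ! (k - 1)), snd \<omega> s k)) [1..<length h + 1]))" for s
      by (rule decision_measurable) (measurable, rule measurable_compose[OF measurable_snd], simp)
    show "Measurable.pred ?N (\<lambda>\<omega>. ?T \<omega> h)"
      unfolding case_prod_beta simulate_def by measurable
  qed (auto simp: space_PiM)
  show P': "?P' \<in> randomized_policies"
    by (rule distr_randomized_policy[OF joint.prob_space_axioms T])
  fix v assume v: "v \<in> instances n"
  let ?i = "best_time n v"
  have i: "?i \<ge> 1" "?i \<le> n" using best_time_in[OF v] by auto
  let ?f = "\<lambda>x. emeasure P {d. stops_at d v x ?i}"
  have le: "(\<integral>\<^sup>+ x. ?f x \<partial>counts_given_last m s) \<le> emeasure ?P' {d. stops_at d v (\<lambda>t. s = t) ?i}"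
    if s: "s \<in> {1..?i}" for s
  proof -
    \<comment> \<open>Coordinate \<open>s\<close> of the product has this law because
      \<open>s\<close> is at most the time of the maximum and hence at most
      \<open>n\<close>.\<close>
    have "counts_given_last m s = map_pmf (\<lambda>C. C s) ?K"
      using s i by (subst Pi_pmf_component) auto
    then have "(\<integral>\<^sup>+ x. ?f x \<partial>counts_given_last m s) = (\<integral>\<^sup>+ C. ?f (C s) \<partial>?K)"
      by simp
    also have "\<dots> = emeasure ?N {(d, C). stops_at d v (C s) ?i}"
      by (rule emeasure_pair_stops_at[OF P, symmetric])
    also have "\<dots> \<le> emeasure ?N {\<omega> \<in> space ?N. stops_at (?T \<omega>) v (\<lambda>t. s = t) ?i}"
    proof (rule emeasure_mono)
      show "{(d, C). stops_at d v (C s) ?i} \<subseteq> {\<omega> \<in> space ?N. stops_at (?T \<omega>) v (\<lambda>t. s = t) ?i}"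
        using stops_at_simulate[OF s] unfolding space_N by auto
      have "Measurable.pred ?N (\<lambda>\<omega>. stops_at (?T \<omega>) v (\<lambda>t. s = t) ?i)"
        by (rule stops_at_measurable[OF T]) simp
      then show "{\<omega> \<in> space ?N. stops_at (?T \<omega>) v (\<lambda>t. s = t) ?i} \<in> sets ?N"
        unfolding pred_def .
    qed
    also have "\<dots> = emeasure ?P' {d. stops_at d v (\<lambda>t. s = t) ?i}"
      by (rule distr_randomized_policy(2)[OF joint.prob_space_axioms T, symmetric])
    finally show ?thesis .
  qed
  have supp: "s \<in> {1..?i}" if "s \<in> set_pmf (power_signal (real m) ?i)" for s
    using that i m by (auto simp: set_pmf_iff pmf_power_signal split: if_splits)
  have "ennreal (success_prob (full_history_model m) n P v) =
      (\<integral>\<^sup>+ s. \<integral>\<^sup>+ x. ?f x \<partial>counts_given_last m s \<partial>power_signal (real m) ?i)"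
    unfolding success_prob_eq_nn_integral[OF P] full_history_model_disintegration[OF m i(1)]
    by simp
  also have "\<dots> \<le> (\<integral>\<^sup>+ s. emeasure ?P' {d. stops_at d v (\<lambda>t. s = t) ?i} \<partial>power_signal (real m) ?i)"
    by (intro nn_integral_mono_AE) (use le supp in \<open>auto simp: AE_measure_pmf_iff\<close>)
  also have "\<dots> = ennreal (success_prob (single_signal_model (real m)) n ?P' v)"
    unfolding success_prob_eq_nn_integral[OF P'] single_signal_model_def by simp
  finally show "success_prob (full_history_model m) n P v \<le>
      success_prob (single_signal_model (real m)) n ?P' v"
    by (simp add: success_prob_def)
qed

theorem theorem8:
  fixes n m :: nat
  assumes "n \<ge> 1" and "m \<ge> 1"
  shows "OPT_rand n (real m) = OPT_rand_full n m"
  unfolding OPT_rand_def OPT_rand_full_def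
  using single_signal_le_full_history[OF assms] full_history_le_single_signal[OF assms]
  by (rule antisym)

end
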